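(* Let $\mu\in\mathcal P(E)$. Suppose that for every $\theta,\alpha\in\Theta$ and $x'\in E$ the probability measures $K_\theta(x',\cdot)$ and $K_\alpha(x',\cdot)$ are absolutely continuous with respect to each other, and that there exist functions $c(\theta,\alpha)$ and $d(\theta,\alpha)$ such that, for all $x,x'\in E$, $$0<c(\theta,\alpha)\le\frac{dK_\theta(x',\cdot)}{dK_\alpha(x',\cdot)}(x)\le c(\theta,\alpha)\exp(d(\theta,\alpha))<+\infty .$$ Then the Hilbert projective distance of the step error is bounded, uniformly in $n\ge1$ and for every realization of the observations, by $$\mathcal H\big(\Psi_n^\theta(\mu),\mathbf K_n^\alpha(\Psi_{n-1}^\theta(\mu))\big)\le\log\left(\sup_{x',x}\frac{dK_\theta(x',\cdot)}{dK_\alpha(x',\cdot)}(x)\ \sup_{x',x}\frac{dK_\alpha(x',\cdot)}{dK_\theta(x',\cdot)}(x)\right)\le d(\theta,\alpha).$$ Consequently, if $\lim_{\theta\to\alpha}d(\theta,\alpha)=0$, then $$\lim_{\theta\to\alpha}\sup_{n\ge 1}\mathcal H\big(\Psi_n^\theta(\mu),\mathbf K_n^\alpha(\Psi_{n-1}^\theta(\mu))\big)=0 .$$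
   Context: Setting. $E$ is a Polish space with Borel $\sigma$-field $\mathcal B(E)$; $\Theta$ is a Polish space with metric $d_\Theta$. For each $\theta\in\Theta$, $K_\theta$ is a Feller transition probability kernel on $E$ that is mixing: there are $0<\epsilon_\theta\le1$ and a finite nonnegative measure $\lambda_\theta$ on $E$ with $\epsilon_\theta\lambda_\theta(A)\le K_\theta(x,A)\le\frac1{\epsilon_\theta}\lambda_\theta(A)$ for all $x\in E$, $A\in\mathcal B(E)$. Observations are $Y_n=h(X_n)+V_n$, $n\ge1$, with $h:E\to\mathbb R^p$ bounded continuous and $(V_n)$ i.i.d. Gaussian$(0,\sigma^2)$ in $\mathbb R^p$ with density $g$, independent of the signal chain $X$. For a probability measure $m$ on $E$, $$\mathbf K_n^{\theta}(m)(dx)=\frac{\int_E g(Y_n-h(x))K_\theta(x',dx)m(dx')}{\int_E\int_E g(Y_n-h(z))K_\theta(z',dz)m(dz')},$$ and the optimal filter is $\Psi_0^\theta(\mu)=\mu$, $\Psi_n^\theta(\mu)=\mathbf K_n^\theta(\Psi_{n-1}^\theta(\mu))$ for $n\ge1$. All quantities are considered for each fixed realization of the observation sequence. $\mathcal H$ is the Hilbert projective metric on finite nonnegative measures: $\mathcal H(m,m')=\log\big(\|\frac{dm}{dm'}\|_\infty\|\frac{dm'}{dm}\|_\infty\big)$ if $m,m'$ are comparable ($a m\le m'\le b m$ for some $a,b>0$), $0$ if $m=m'\equiv0$, and $+\infty$ otherwise. *)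

theory Defs
  imports "HOL-Probability.Probability"
begin

section \<open>Kernels\<close>

definition feller_kernel :: "('e::polish_space \<Rightarrow> 'e measure) \<Rightarrow> bool" where
  "feller_kernel \<kappa> \<longleftrightarrow>
     \<kappa> \<in> borel \<rightarrow>\<^sub>M prob_algebra borel \<and>
     (\<forall>f :: 'e \<Rightarrow> real. continuous_on UNIV f \<and> bounded (range f) \<longrightarrow>
        continuous_on UNIV (\<lambda>x. \<integral>y. f y \<partial>\<kappa> x))"

definition mixing_kernel :: "('e::polish_space \<Rightarrow> 'e measure) \<Rightarrow> bool" where
  "mixing_kernel \<kappa> \<longleftrightarrow>
     (\<exists>(\<epsilon>::real) (\<Lambda>::'e measure).
        0 < \<epsilon> \<and> \<epsilon> \<le> 1 \<and> finite_measure \<Lambda> \<and> sets \<Lambda> = sets borel \<and>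
        (\<forall>x. \<forall>A\<in>sets borel.
           ennreal \<epsilon> * emeasure \<Lambda> A \<le> emeasure (\<kappa> x) A \<and>
           emeasure (\<kappa> x) A \<le> ennreal (1 / \<epsilon>) * emeasure \<Lambda> A))"


section \<open>Signal and observations\<close>

text \<open>The conditioning \<open>\<sigma>\<close>-algebra is the one generated by \<open>X 0, \<dots>, X n\<close>; the initial law
  is unconstrained.\<close>

definition markov_chain :: "'w measure \<Rightarrow> ('e::polish_space \<Rightarrow> 'e measure) \<Rightarrow> (nat \<Rightarrow> 'w \<Rightarrow> 'e) \<Rightarrow> bool" where
  "markov_chain M \<kappa> X \<longleftrightarrow>
     (\<forall>n. X n \<in> M \<rightarrow>\<^sub>M borel) \<and>
     (\<forall>n. \<forall>A\<in>sets borel. AE \<omega> in M.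
        real_cond_exp M
          (vimage_algebra (space M) (\<lambda>\<omega>. \<lambda>i\<in>{..n}. X i \<omega>) (\<Pi>\<^sub>M i\<in>{..n}. borel))
          (\<lambda>\<omega>. indicator A (X (Suc n) \<omega>)) \<omega>
        = measure (\<kappa> (X n \<omega>)) A)"

text \<open>Density of the Gaussian law on \<open>\<real>\<^sup>p\<close> with mean \<open>0\<close> and covariance matrix \<open>\<sigma>\<^sup>2\<close> times the
  identity; \<open>\<sigma>\<close> is the standard deviation.\<close>

definition gauss_density :: "real \<Rightarrow> real ^ 'p \<Rightarrow> real" where
  "gauss_density \<sigma> v = (\<Prod>i\<in>UNIV. normal_density 0 \<sigma> (v $ i))"

text \<open>The noise is indexed by \<open>n \<ge> 1\<close> (no observation is made at time \<open>0\<close>), and is independent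
  of the signal as a process.\<close>

definition observation_model ::
    "'w measure \<Rightarrow> (nat \<Rightarrow> 'w \<Rightarrow> 'e::polish_space) \<Rightarrow> (nat \<Rightarrow> 'w \<Rightarrow> real ^ 'p)
     \<Rightarrow> ('e \<Rightarrow> real ^ 'p) \<Rightarrow> real \<Rightarrow> (nat \<Rightarrow> 'w \<Rightarrow> real ^ 'p) \<Rightarrow> bool" where
  "observation_model M X V h \<sigma> Y \<longleftrightarrow>
     (\<forall>n\<ge>1. distributed M lborel (V n) (\<lambda>v. ennreal (gauss_density \<sigma> v))) \<and>
     prob_space.indep_vars M (\<lambda>_. borel) V {1..} \<and>
     prob_space.indep_set M
       (sets (vimage_algebra (space M) (\<lambda>\<omega>. \<lambda>n\<in>UNIV. X n \<omega>) (\<Pi>\<^sub>M n\<in>UNIV. borel)))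
       (sets (vimage_algebra (space M) (\<lambda>\<omega>. \<lambda>n\<in>{1..}. V n \<omega>) (\<Pi>\<^sub>M n\<in>{1..}. borel))) \<and>
     (\<forall>n\<ge>1. \<forall>\<omega>\<in>space M. Y n \<omega> = h (X n \<omega>) + V n \<omega>)"


section \<open>The optimal filter\<close>

text \<open>\<open>m \<bind> \<kappa>\<close> is the predicted law \<open>A \<mapsto> \<integral> \<kappa> x' A m(dx')\<close>; the update reweights it by the
  likelihood \<open>g (y - h x)\<close> and normalises.\<close>

definition filter_step ::
    "('e::polish_space \<Rightarrow> 'e measure) \<Rightarrow> ('o::real_normed_vector \<Rightarrow> real) \<Rightarrow> ('e \<Rightarrow> 'o) \<Rightarrow> 'o
     \<Rightarrow> 'e measure \<Rightarrow> 'e measure" where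
  "filter_step \<kappa> g h y m =
     density (m \<bind> \<kappa>)
       (\<lambda>x. ennreal (g (y - h x)) /
            (\<integral>\<^sup>+z'. (\<integral>\<^sup>+z. ennreal (g (y - h z)) \<partial>\<kappa> z') \<partial>m))"

primrec optimal_filter ::
    "('e::polish_space \<Rightarrow> 'e measure) \<Rightarrow> ('o::real_normed_vector \<Rightarrow> real) \<Rightarrow> ('e \<Rightarrow> 'o) \<Rightarrow> (nat \<Rightarrow> 'o)
     \<Rightarrow> 'e measure \<Rightarrow> nat \<Rightarrow> 'e measure" where
  "optimal_filter \<kappa> g h y \<mu> 0 = \<mu>"
| "optimal_filter \<kappa> g h y \<mu> (Suc n) =
     filter_step \<kappa> g h (y (Suc n)) (optimal_filter \<kappa> g h y \<mu> n)"


section \<open>Hilbert projective metric\<close>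

definition elog :: "ennreal \<Rightarrow> ereal" where
  "elog t = (if t = 0 then - \<infinity> else if t = \<infinity> then \<infinity> else ereal (ln (enn2real t)))"

definition comparable :: "'a measure \<Rightarrow> 'a measure \<Rightarrow> bool" where
  "comparable m m' \<longleftrightarrow>
     sets m = sets m' \<and>
     (\<exists>(a::real) (b::real). 0 < a \<and> 0 < b \<and>
        (\<forall>A\<in>sets m.
           ennreal a * emeasure m A \<le> emeasure m' A \<and>
           emeasure m' A \<le> ennreal b * emeasure m A))"

text \<open>Two null measures satisfy \<open>comparable\<close>, hence the zero case is tested first.
  Note that \<open>RN_deriv m' m\<close> is \<open>dm / dm'\<close>.\<close>

definition hilbert_dist :: "'a measure \<Rightarrow> 'a measure \<Rightarrow> ereal" where
  "hilbert_dist m m' =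
     (if sets m = sets m' \<and> emeasure m (space m) = 0 \<and> emeasure m' (space m') = 0 then 0
      else if comparable m m' then
        elog (esssup m' (RN_deriv m' m) * esssup m (RN_deriv m m'))
      else \<infinity>)"


section \<open>Supremum of the kernel densities\<close>

text \<open>\<open>sup\<^bsub>x',x\<^esub> (d\<kappa>(x',\<cdot>) / d\<eta>(x',\<cdot>))(x)\<close>. A Radon--Nikodym derivative is determined only up to
  \<open>\<eta>(x',\<cdot>)\<close>-null sets, so the supremum over \<open>x\<close> is the essential one; the supremum over \<open>x'\<close> is
  an ordinary supremum.\<close>

definition sup_kernel_deriv :: "('e \<Rightarrow> 'e measure) \<Rightarrow> ('e \<Rightarrow> 'e measure) \<Rightarrow> ennreal" where
  "sup_kernel_deriv \<kappa> \<eta> = (SUP x'. esssup (\<eta> x') (RN_deriv (\<eta> x') (\<kappa> x')))"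

end

theory Submission
  imports Defs
begin

text \<open>If \<open>K\<^sub>\<theta>(x', \<cdot>) \<le> a K\<^sub>\<alpha>(x', \<cdot>)\<close> and \<open>K\<^sub>\<alpha>(x', \<cdot>) \<le> b K\<^sub>\<theta>(x', \<cdot>)\<close> for all \<open>x'\<close>, then the same
  inequalities survive integration against a prior and reweighting by the likelihood. Normalising
  by \<open>Z\<^sub>\<theta>\<close> and \<open>Z\<^sub>\<alpha>\<close> turns the constants into \<open>a Z\<^sub>\<alpha> / Z\<^sub>\<theta>\<close> and \<open>b Z\<^sub>\<theta> / Z\<^sub>\<alpha>\<close>, whose product is still
  \<open>a b\<close>. The best constants \<open>a\<close>, \<open>b\<close> are the suprema of the densities, and
  \<open>a \<le> c exp d\<close>, \<open>b \<le> 1 / c\<close>.\<close>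

section \<open>Domination of measures and Radon--Nikodym derivatives\<close>

lemma le_scale_measure_iff:
  assumes "sets N = sets M"
  shows "N \<le> scale_measure t M \<longleftrightarrow> (\<forall>A\<in>sets M. emeasure N A \<le> t * emeasure M A)"
  using assms by (simp add: le_measure)

lemma le_scale_measureD:
  assumes "sets N = sets M" "N \<le> scale_measure t M"
  shows "emeasure N A \<le> t * emeasure M A"
  using assms by (metis emeasure_scale_measure le_measureD3 sets_scale_measure)

lemma nn_integral_le_scale_measure:
  assumes "sets N = sets M" "N \<le> scale_measure t M" "f \<in> borel_measurable M"
  shows "(\<integral>\<^sup>+x. f x \<partial>N) \<le> t * (\<integral>\<^sup>+x. f x \<partial>M)"
  using nn_integral_mono_measure[of N "scale_measure t M" f] assms
  by (simp add: nn_integral_scale_measure)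

lemma scale_measure_leI:
  assumes "s \<le> t"
  shows "scale_measure s M \<le> scale_measure t M"
  using assms by (subst le_measure) (auto intro: mult_right_mono)

text \<open>\<open>N\<close> is the density of \<open>RN_deriv M N\<close> with respect to
  \<open>M\<close>, and that derivative lies almost everywhere below its essential supremum. The
  next lemma shows that, for finite \<open>M\<close>, no smaller constant dominates.\<close>

lemma (in sigma_finite_measure) le_scale_esssup_RN_deriv:
  assumes "absolutely_continuous M N" "sets N = sets M"
  shows "N \<le> scale_measure (esssup M (RN_deriv M N)) M"
  unfolding le_scale_measure_iff[OF assms(2)]
proof
  fix A assume A: "A \<in> sets M"
  have "emeasure N A = (\<integral>\<^sup>+x\<in>A. RN_deriv M N x \<partial>M)"
    using emeasure_density[OF borel_measurable_RN_deriv A] density_RN_deriv[OF assms] by metis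
  also have "\<dots> \<le> (\<integral>\<^sup>+x\<in>A. esssup M (RN_deriv M N) \<partial>M)"
    using esssup_AE[of "RN_deriv M N" M]
    by (intro nn_integral_mono_AE) (auto split: split_indicator)
  also have "\<dots> = esssup M (RN_deriv M N) * emeasure M A"
    using A by (simp add: nn_integral_cmult_indicator)
  finally show "emeasure N A \<le> esssup M (RN_deriv M N) * emeasure M A" .
qed

text \<open>On the set where the derivative exceeds \<open>t\<close>, domination says that its
  integral is at most that of the constant \<open>t\<close>, so the set is null. This replaces
  handling of versions of the derivative by an inequality between measures.\<close>

lemma (in finite_measure) esssup_RN_deriv_le:
  assumes N: "sets N = sets M" and le: "N \<le> scale_measure t M"
  shows "esssup M (RN_deriv M N) \<le> t"
proof (cases "t = \<infinity>")
  case False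
  define f where "f = RN_deriv M N"
  have [measurable]: "f \<in> borel_measurable M"
    by (simp add: f_def)
  \<comment> \<open>Domination itself gives absolute continuity: \<open>t\<close> times zero is
    zero.\<close>
  have ac: "absolutely_continuous M N"
    unfolding absolutely_continuous_def
  proof
    fix A assume "A \<in> null_sets M"
    then show "A \<in> null_sets N"
      using le_scale_measureD[OF N le, of A] by (auto simp: null_sets_def N)
  qed
  define A where "A = {x \<in> space M. t < f x}"
  have A[measurable]: "A \<in> sets M"
    by (simp add: A_def)
  \<comment> \<open>Finiteness of this integral is what allows the two integrals to be subtracted
    below; the case of infinite \<open>t\<close> was split off for that reason.\<close>
  have fin: "t * emeasure M A < \<infinity>"
    using False by (simp add: emeasure_eq_measure ennreal_mult_eq_top_iff less_top[symmetric])
  have int_t: "(\<integral>\<^sup>+x\<in>A. t \<partial>M) = t * emeasure M A"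
    by (simp add: nn_integral_cmult_indicator)
  have int_f: "(\<integral>\<^sup>+x\<in>A. f x \<partial>M) = emeasure N A"
    unfolding f_def
    using emeasure_density[OF borel_measurable_RN_deriv A] density_RN_deriv[OF ac N] by metis
  \<comment> \<open>Subtraction in \<open>ennreal\<close> is truncated at 0, but on \<open>A\<close>
    the integrand is a strictly positive excess. Its integral is \<open>N A\<close> minus
    \<open>t * M A\<close>, which truncates to 0.\<close>
  have "(\<integral>\<^sup>+x. f x * indicator A x - t * indicator A x \<partial>M)
      = (\<integral>\<^sup>+x\<in>A. f x \<partial>M) - (\<integral>\<^sup>+x\<in>A. t \<partial>M)"
    using fin int_t by (intro nn_integral_diff) (auto simp: A_def split: split_indicator)
  also have "\<dots> = 0"
    using le_scale_measureD[OF N le, of A] fin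
    by (simp add: int_f int_t diff_eq_0_iff_ennreal less_top)
  finally have "AE x in M. f x * indicator A x - t * indicator A x = 0"
    by (subst (asm) nn_integral_0_iff_AE) auto
  with AE_space have "AE x in M. f x \<le> t"
  proof eventually_elim
    case (elim x)
    show ?case
    proof (rule ccontr)
      assume "\<not> f x \<le> t"
      moreover from this have "x \<in> A"
        using elim by (simp add: A_def)
      ultimately show False
        using elim False by (simp add: diff_eq_0_iff_ennreal less_top)
    qed
  qed
  then show ?thesis
    unfolding f_def by (intro esssup_I) auto
qed simp

text \<open>Integrating the lower bound over \<open>A\<close> and dividing by \<open>c\<close>
  reverses the direction of domination. With \<open>esssup_RN_deriv_le\<close> this bounds the
  derivative of \<open>M\<close> by \<open>N\<close> without showing that the two derivatives are
  reciprocal.\<close>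

lemma (in sigma_finite_measure) le_scale_measure_of_RN_deriv_ge:
  assumes ac: "absolutely_continuous M N" "sets N = sets M"
    and c: "0 < c" "AE x in M. ennreal c \<le> RN_deriv M N x"
  shows "M \<le> scale_measure (ennreal (1 / c)) N"
  unfolding le_scale_measure_iff[OF ac(2)[symmetric]]
proof
  fix A assume "A \<in> sets N"
  then have A: "A \<in> sets M"
    by (simp add: ac(2))
  have "ennreal c * emeasure M A = (\<integral>\<^sup>+x\<in>A. ennreal c \<partial>M)"
    using A by (simp add: nn_integral_cmult_indicator)
  also have "\<dots> \<le> (\<integral>\<^sup>+x\<in>A. RN_deriv M N x \<partial>M)"
    using c(2) by (intro nn_integral_mono_AE) (auto split: split_indicator)
  also have "\<dots> = emeasure N A"
    using emeasure_density[OF borel_measurable_RN_deriv A] density_RN_deriv[OF ac] by metis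
  finally have "ennreal (1 / c) * (ennreal c * emeasure M A) \<le> ennreal (1 / c) * emeasure N A"
    by (rule mult_left_mono) simp
  then show "emeasure M A \<le> ennreal (1 / c) * emeasure N A"
    using c(1) by (simp add: mult.assoc[symmetric] ennreal_mult[symmetric])
qed

section \<open>Bounding the Hilbert distance\<close>

lemma elog_mono:
  assumes "s \<le> t"
  shows "elog s \<le> elog t"
proof (cases "s = 0 \<or> t = \<infinity>")
  case False
  then have "s \<noteq> 0" "t \<noteq> \<infinity>" by auto
  moreover from this assms have "t \<noteq> 0" "s \<noteq> \<infinity>"
    by (auto simp: top_unique)
  ultimately show ?thesis
    using assms by (cases s; cases t) (auto simp: elog_def ennreal_eq_0_iff not_le)
qed (auto simp: elog_def)

lemma elog_ennreal_exp: "elog (ennreal (exp x)) = ereal x"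
  by (simp add: elog_def)

lemma elog_1: "elog 1 = 0"
  by (simp add: elog_def zero_ereal_def)

lemma comparableI:
  assumes sets: "sets m = sets m'" and nonnull: "emeasure m (space m) \<noteq> 0"
    and s: "m \<le> scale_measure s m'" "s < \<infinity>"
    and t: "m' \<le> scale_measure t m" "t < \<infinity>"
  shows "comparable m m'"
proof -
  have le_s: "emeasure m A \<le> s * emeasure m' A" for A
    using le_scale_measureD[OF sets s(1)] .
  have le_t: "emeasure m' A \<le> t * emeasure m A" for A
    using le_scale_measureD[OF sets[symmetric] t(1)] .
  \<comment> \<open>If either constant vanished, \<open>m\<close> would have total mass 0. With
    finiteness, both are positive reals, and the witnesses for \<open>comparable\<close> are
    \<open>1 / s'\<close> and \<open>t'\<close>.\<close>
  have "s \<noteq> 0" "t \<noteq> 0"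
    using le_s[of "space m"] le_t[of "space m"] nonnull by auto
  then obtain s' t' where s': "s = ennreal s'" "0 < s'" and t': "t = ennreal t'" "0 < t'"
    using s(2) t(2) by (cases s; cases t) (auto simp: less_le)
  have "ennreal (1 / s') * emeasure m A \<le> emeasure m' A" for A
  proof -
    have "ennreal (1 / s') * emeasure m A \<le> ennreal (1 / s') * (s * emeasure m' A)"
      using le_s by (rule mult_left_mono) simp
    also have "\<dots> = emeasure m' A"
      using s' by (simp add: mult.assoc[symmetric] ennreal_mult[symmetric])
    finally show ?thesis .
  qed
  then show ?thesis
    unfolding comparable_def using sets le_t s' t'
    by (intro conjI exI[of _ "1 / s'"] exI[of _ t']) auto
qed

text \<open>Any pair of domination constants bounds the two essential suprema in the definition.
  Non-nullity of \<open>m\<close> excludes the zero branch, and finite constants exclude the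
  infinite one.\<close>

lemma hilbert_dist_le_elog:
  assumes fin: "finite_measure m" "finite_measure m'" and sets: "sets m = sets m'"
    and nonnull: "emeasure m (space m) \<noteq> 0"
    and s: "m \<le> scale_measure s m'" "s < \<infinity>"
    and t: "m' \<le> scale_measure t m" "t < \<infinity>"
  shows "hilbert_dist m m' \<le> elog (s * t)"
proof -
  have "esssup m' (RN_deriv m' m) \<le> s"
    using finite_measure.esssup_RN_deriv_le[OF fin(2) sets s(1)] .
  moreover have "esssup m (RN_deriv m m') \<le> t"
    using finite_measure.esssup_RN_deriv_le[OF fin(1) sets[symmetric] t(1)] .
  ultimately show ?thesis
    unfolding hilbert_dist_def using nonnull comparableI[OF sets nonnull s t]
    by (auto intro!: elog_mono mult_mono)
qed

text \<open>Both total masses are 1, so a dominating constant cannot be smaller than 1.\<close>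

lemma one_le_esssup_RN_deriv:
  assumes M: "prob_space M" and N: "prob_space N"
    and ac: "absolutely_continuous M N" "sets N = sets M"
  shows "1 \<le> esssup M (RN_deriv M N)"
proof -
  interpret M: prob_space M by fact
  show ?thesis
    using le_scale_measureD[OF ac(2) M.le_scale_esssup_RN_deriv[OF ac], of "space M"]
      prob_space.emeasure_space_1[OF N] sets_eq_imp_space_eq[OF ac(2)]
    by (simp add: M.emeasure_space_1)
qed

text \<open>Serves as the lower bound in the squeeze argument for the limit. In the comparable case
  both essential suprema are at least 1, so the logarithm of their product is nonnegative.\<close>

lemma hilbert_dist_nonneg:
  assumes m: "prob_space m" and m': "prob_space m'"
  shows "0 \<le> hilbert_dist m m'"
proof (cases "comparable m m'")
  case True
  then obtain a b :: real where ab: "0 < a" "0 < b" and sets: "sets m = sets m'"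
    and le: "\<And>A. A \<in> sets m \<Longrightarrow> ennreal a * emeasure m A \<le> emeasure m' A"
      "\<And>A. A \<in> sets m \<Longrightarrow> emeasure m' A \<le> ennreal b * emeasure m A"
    by (auto simp: comparable_def)
  have ac: "absolutely_continuous m' m" "absolutely_continuous m m'"
    unfolding absolutely_continuous_def null_sets_def using ab le sets
    by (fastforce simp: ennreal_eq_0_iff)+
  have "1 * 1 \<le> esssup m' (RN_deriv m' m) * esssup m (RN_deriv m m')"
    using one_le_esssup_RN_deriv m m' ac sets by (intro mult_mono) auto
  then have "0 \<le> elog (esssup m' (RN_deriv m' m) * esssup m (RN_deriv m m'))"
    using elog_mono elog_1 by fastforce
  then show ?thesis
    using True by (simp add: hilbert_dist_def)
qed (simp add: hilbert_dist_def)

section \<open>The filter step\<close>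

lemma bind_le_scale_measure:
  assumes ne: "space m \<noteq> {}"
    and \<kappa>: "\<kappa> \<in> m \<rightarrow>\<^sub>M subprob_algebra N" and \<eta>: "\<eta> \<in> m \<rightarrow>\<^sub>M subprob_algebra N"
    and le: "\<And>x. x \<in> space m \<Longrightarrow> \<kappa> x \<le> scale_measure t (\<eta> x)"
  shows "m \<bind> \<kappa> \<le> scale_measure t (m \<bind> \<eta>)"
proof -
  have sets: "sets (m \<bind> \<kappa>) = sets N" "sets (m \<bind> \<eta>) = sets N"
    using sets_bind[OF sets_kernel[OF \<kappa>] ne] sets_bind[OF sets_kernel[OF \<eta>] ne] by auto
  have "emeasure (m \<bind> \<kappa>) A \<le> t * emeasure (m \<bind> \<eta>) A" if A: "A \<in> sets N" for A
  proof -
    have "emeasure (m \<bind> \<kappa>) A = (\<integral>\<^sup>+x. emeasure (\<kappa> x) A \<partial>m)"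
      by (rule emeasure_bind[OF ne \<kappa> A])
    also have "\<dots> \<le> (\<integral>\<^sup>+x. t * emeasure (\<eta> x) A \<partial>m)"
      using le sets_kernel[OF \<kappa>] sets_kernel[OF \<eta>]
      by (intro nn_integral_mono le_scale_measureD) auto
    also have "\<dots> = t * emeasure (m \<bind> \<eta>) A"
      using A \<eta> by (simp add: emeasure_bind[OF ne \<eta> A] nn_integral_cmult measurable_emeasure_kernel)
    finally show ?thesis .
  qed
  then show ?thesis
    by (subst le_scale_measure_iff) (auto simp: sets)
qed

text \<open>Reweighting by a common \<open>f\<close> preserves the constant \<open>t\<close>; the
  two normalisers then change it to \<open>t * b / a\<close>. The conditions on \<open>b\<close>
  make \<open>b / b = 1\<close>, which cancels the denominator on the right.\<close>

lemma density_divide_le_scale_measure: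
  assumes sets: "sets N = sets M" and le: "N \<le> scale_measure t M"
    and f[measurable]: "f \<in> borel_measurable M"
    and b: "b \<noteq> 0" "b \<noteq> (\<infinity>::ennreal)"
  shows "density N (\<lambda>x. f x / a) \<le> scale_measure (t * b / a) (density M (\<lambda>x. f x / b))"
proof (subst le_scale_measure_iff, simp add: sets, safe)
  fix A assume "A \<in> sets (density M (\<lambda>x. f x / b))"
  then have A[measurable]: "A \<in> sets M" by simp
  have f': "f \<in> borel_measurable N" "A \<in> sets N"
    using f A by (simp_all add: sets cong: measurable_cong_sets)
  \<comment> \<open>Moves the constant divisor outermost, so that it can leave the integral.\<close>
  have eq: "f x / r * indicator A x = f x * indicator A x / r" for x and r :: ennreal
    by (simp split: split_indicator)
  have "emeasure (density N (\<lambda>x. f x / a)) A = (\<integral>\<^sup>+x\<in>A. f x \<partial>N) / a"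
    using f' by (simp add: emeasure_density eq nn_integral_divide)
  also have "\<dots> \<le> (t * (\<integral>\<^sup>+x\<in>A. f x \<partial>M)) / a"
    using nn_integral_le_scale_measure[OF sets le, of "\<lambda>x. f x * indicator A x"]
    by (intro divide_right_mono_ennreal) auto
  also have "\<dots> = t * b / a * ((\<integral>\<^sup>+x\<in>A. f x \<partial>M) / b)"
  proof -
    have "t * b / a * ((\<integral>\<^sup>+x\<in>A. f x \<partial>M) / b) = (t * (\<integral>\<^sup>+x\<in>A. f x \<partial>M)) / a * (b / b)"
      by (simp add: divide_ennreal_def mult_ac)
    then show ?thesis
      using b by (simp add: ennreal_divide_self less_top zero_less_iff_neq_zero)
  qed
  also have "\<dots> = t * b / a * emeasure (density M (\<lambda>x. f x / b)) A"
    by (simp add: emeasure_density eq nn_integral_divide)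
  finally show "emeasure (density N (\<lambda>x. f x / a)) A
    \<le> t * b / a * emeasure (density M (\<lambda>x. f x / b)) A" .
qed

context
  fixes g :: "'o::real_normed_vector \<Rightarrow> real" and h :: "'e::polish_space \<Rightarrow> 'o" and y :: 'o and B :: real
  assumes likelihood_measurable[measurable]: "(\<lambda>x. g (y - h x)) \<in> borel_measurable borel"
    and likelihood_pos: "\<And>x. 0 < g (y - h x)"
    and likelihood_le: "\<And>x. g (y - h x) \<le> B"
begin

text \<open>Strict positivity of the likelihood keeps the normaliser away from 0, and the bound
  \<open>B\<close> keeps it finite. Both are needed to cancel normalisers in
  \<open>ennreal\<close>.\<close>

lemma nn_integral_likelihood:
  assumes "prob_space P" "sets P = sets borel"
  shows "(\<integral>\<^sup>+x. ennreal (g (y - h x)) \<partial>P) \<noteq> 0" "(\<integral>\<^sup>+x. ennreal (g (y - h x)) \<partial>P) \<noteq> \<infinity>"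
proof -
  interpret prob_space P by fact
  have [measurable]: "(\<lambda>x. g (y - h x)) \<in> borel_measurable P"
    using assms(2) likelihood_measurable by (simp cong: measurable_cong_sets)
  show "(\<integral>\<^sup>+x. ennreal (g (y - h x)) \<partial>P) \<noteq> 0"
    using likelihood_pos[unfolded not_le[symmetric]]
    by (subst nn_integral_0_iff_AE) (auto simp: ennreal_eq_0_iff)
  have "(\<integral>\<^sup>+x. ennreal (g (y - h x)) \<partial>P) \<le> (\<integral>\<^sup>+x. ennreal B \<partial>P)"
    using likelihood_le by (intro nn_integral_mono ennreal_leI) auto
  then show "(\<integral>\<^sup>+x. ennreal (g (y - h x)) \<partial>P) \<noteq> \<infinity>"
    by (auto simp: emeasure_space_1 top_unique)
qed

text \<open>The iterated integral in the definition is the integral of the likelihood against the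
  predicted law, so the step is a density whose base measure and normaliser come from the same
  measure.\<close>

lemma filter_step_eq_density:
  assumes m: "m \<in> space (prob_algebra borel)" and \<kappa>: "\<kappa> \<in> borel \<rightarrow>\<^sub>M prob_algebra borel"
  shows "filter_step \<kappa> g h y m = density (m \<bind> \<kappa>)
    (\<lambda>x. ennreal (g (y - h x)) / (\<integral>\<^sup>+z. ennreal (g (y - h z)) \<partial>(m \<bind> \<kappa>)))"
proof -
  have "\<kappa> \<in> m \<rightarrow>\<^sub>M subprob_algebra borel"
    using m measurable_prob_algebraD[OF \<kappa>] by (simp add: space_prob_algebra cong: measurable_cong_sets)
  then show ?thesis
    unfolding filter_step_def by (subst nn_integral_bind[where B = borel]) auto
qed

text \<open>Closes the filter recursion: the posterior is again an admissible prior.\<close>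

lemma filter_step_in_prob_algebra:
  assumes m: "m \<in> space (prob_algebra borel)" and \<kappa>: "\<kappa> \<in> borel \<rightarrow>\<^sub>M prob_algebra borel"
  shows "filter_step \<kappa> g h y m \<in> space (prob_algebra borel)"
proof -
  note P = prob_space_bind'[OF m \<kappa>] sets_bind'[OF m \<kappa>]
  have [measurable]: "(\<lambda>x. g (y - h x)) \<in> borel_measurable (m \<bind> \<kappa>)"
    using P(2) likelihood_measurable by (simp cong: measurable_cong_sets)
  have "emeasure (filter_step \<kappa> g h y m) (space (filter_step \<kappa> g h y m)) = 1"
    using nn_integral_likelihood[OF P]
    by (simp add: filter_step_eq_density[OF m \<kappa>] emeasure_density nn_integral_divide
        ennreal_divide_self less_top zero_less_iff_neq_zero cong: nn_integral_cong_simp)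
  then show ?thesis
    by (auto simp: space_prob_algebra filter_step_def P(2) intro!: prob_spaceI)
qed

lemma hilbert_dist_filter_step_le:
  assumes m: "m \<in> space (prob_algebra borel)"
    and \<kappa>: "\<kappa> \<in> borel \<rightarrow>\<^sub>M prob_algebra borel" and \<eta>: "\<eta> \<in> borel \<rightarrow>\<^sub>M prob_algebra borel"
    and s: "\<And>x. \<kappa> x \<le> scale_measure s (\<eta> x)" "s < \<infinity>"
    and t: "\<And>x. \<eta> x \<le> scale_measure t (\<kappa> x)" "t < \<infinity>"
  shows "hilbert_dist (filter_step \<kappa> g h y m) (filter_step \<eta> g h y m) \<le> elog (s * t)"
proof -
  note P = prob_space_bind'[OF m \<kappa>] sets_bind'[OF m \<kappa>]
    and Q = prob_space_bind'[OF m \<eta>] sets_bind'[OF m \<eta>]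
  define a where "a = (\<integral>\<^sup>+z. ennreal (g (y - h z)) \<partial>(m \<bind> \<kappa>))"
  define b where "b = (\<integral>\<^sup>+z. ennreal (g (y - h z)) \<partial>(m \<bind> \<eta>))"
  have a: "a \<noteq> 0" "a \<noteq> \<infinity>" and b: "b \<noteq> 0" "b \<noteq> \<infinity>"
    using nn_integral_likelihood[OF P] nn_integral_likelihood[OF Q] by (auto simp: a_def b_def)
  have meas: "(\<lambda>x. ennreal (g (y - h x))) \<in> borel_measurable (m \<bind> \<kappa>)"
    "(\<lambda>x. ennreal (g (y - h x))) \<in> borel_measurable (m \<bind> \<eta>)"
    by (simp_all add: P(2) Q(2) cong: measurable_cong_sets)
  have ne: "space m \<noteq> {}" and sets_m: "sets m = sets borel"
    using m by (auto simp: space_prob_algebra dest: prob_space.not_empty)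
  have ker: "\<kappa> \<in> m \<rightarrow>\<^sub>M subprob_algebra borel" "\<eta> \<in> m \<rightarrow>\<^sub>M subprob_algebra borel"
    using measurable_prob_algebraD[OF \<kappa>] measurable_prob_algebraD[OF \<eta>] sets_m
    by (simp_all cong: measurable_cong_sets)
  have F: "filter_step \<kappa> g h y m \<le> scale_measure (s * b / a) (filter_step \<eta> g h y m)"
    unfolding filter_step_eq_density[OF m \<kappa>] filter_step_eq_density[OF m \<eta>] a_def[symmetric] b_def[symmetric]
    using bind_le_scale_measure[OF ne ker s(1)] P(2) Q(2) meas b
    by (intro density_divide_le_scale_measure) auto
  have G: "filter_step \<eta> g h y m \<le> scale_measure (t * a / b) (filter_step \<kappa> g h y m)"
    unfolding filter_step_eq_density[OF m \<kappa>] filter_step_eq_density[OF m \<eta>] a_def[symmetric] b_def[symmetric]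
    using bind_le_scale_measure[OF ne ker(2,1) t(1)] P(2) Q(2) meas a
    by (intro density_divide_le_scale_measure) auto
  have fin: "s * b / a < \<infinity>" "t * a / b < \<infinity>"
    using a b s(2) t(2)
    by (simp_all add: ennreal_mult_less_top ennreal_divide_eq_top_iff less_top[symmetric]
        ennreal_mult_eq_top_iff)
  \<comment> \<open>The normalisers enter the two directions inversely and cancel. This removes the
    observation \<open>y\<close> and the prior \<open>m\<close> from the bound.\<close>
  have "(s * b / a) * (t * a / b) = s * t * (a / a) * (b / b)"
    by (simp add: divide_ennreal_def mult_ac)
  also have "\<dots> = s * t"
    using a b by (simp add: ennreal_divide_self less_top zero_less_iff_neq_zero)
  finally have "(s * b / a) * (t * a / b) = s * t" .
  moreover have "hilbert_dist (filter_step \<kappa> g h y m) (filter_step \<eta> g h y m)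
      \<le> elog ((s * b / a) * (t * a / b))"
    using filter_step_in_prob_algebra[OF m \<kappa>] filter_step_in_prob_algebra[OF m \<eta>]
    by (intro hilbert_dist_le_elog F G fin)
      (auto simp: space_prob_algebra prob_space.emeasure_space_1 prob_space.finite_measure)
  ultimately show ?thesis by simp
qed

end

section \<open>The Gaussian likelihood and the filter it generates\<close>

lemma gauss_density_pos: "0 < \<sigma> \<Longrightarrow> 0 < gauss_density \<sigma> v"
  by (auto simp: gauss_density_def normal_density_pos intro!: prod_pos)

text \<open>Each factor is at most the peak value of the one-dimensional normal density. The product
  of the peaks supplies the bound \<open>B\<close> on the likelihood.\<close>

lemma gauss_density_le:
  fixes v :: "real ^ 'p"
  assumes "0 < \<sigma>"
  shows "gauss_density \<sigma> v \<le> (1 / sqrt (2 * pi * \<sigma>\<^sup>2)) ^ CARD('p)"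
proof -
  have "normal_density 0 \<sigma> x \<le> 1 / sqrt (2 * pi * \<sigma>\<^sup>2)" for x
    using assms by (simp add: normal_density_def divide_right_mono)
  then have "gauss_density \<sigma> v \<le> (\<Prod>i\<in>(UNIV :: 'p set). 1 / sqrt (2 * pi * \<sigma>\<^sup>2))"
    unfolding gauss_density_def by (intro prod_mono) auto
  then show ?thesis by simp
qed

lemma borel_measurable_gauss_density[measurable]: "gauss_density \<sigma> \<in> borel_measurable borel"
  unfolding gauss_density_def[abs_def] by measurable

lemma optimal_filter_in_prob_algebra:
  assumes \<kappa>: "\<kappa> \<in> borel \<rightarrow>\<^sub>M prob_algebra borel" and \<mu>: "\<mu> \<in> space (prob_algebra borel)"
    and g: "\<And>y. (\<lambda>x. g (y - h x)) \<in> borel_measurable borel" "\<And>v. 0 < g v" "\<And>v. g v \<le> B"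
  shows "optimal_filter \<kappa> g h y \<mu> n \<in> space (prob_algebra borel)"
  by (induction n) (simp_all add: \<mu> filter_step_in_prob_algebra[OF g(1,2,3) _ \<kappa>])

section \<open>Suprema of the kernel densities\<close>

text \<open>Provides one constant valid for all starting points, as required for integrating the
  domination against an arbitrary prior.\<close>

lemma le_scale_sup_kernel_deriv:
  assumes "sigma_finite_measure (\<eta> x)" "absolutely_continuous (\<eta> x) (\<kappa> x)" "sets (\<kappa> x) = sets (\<eta> x)"
  shows "\<kappa> x \<le> scale_measure (sup_kernel_deriv \<kappa> \<eta>) (\<eta> x)"
  using sigma_finite_measure.le_scale_esssup_RN_deriv[OF assms]
    scale_measure_leI[of "esssup (\<eta> x) (RN_deriv (\<eta> x) (\<kappa> x))" "sup_kernel_deriv \<kappa> \<eta>" "\<eta> x"]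
  unfolding sup_kernel_deriv_def by (meson SUP_upper UNIV_I order_trans)

theorem lemma4p5:
  fixes K :: "'t::polish_space \<Rightarrow> 'e::polish_space \<Rightarrow> 'e measure"
    and M :: "'w measure"
    and X :: "nat \<Rightarrow> 'w \<Rightarrow> 'e"
    and V Y :: "nat \<Rightarrow> 'w \<Rightarrow> real ^ 'p"
    and h :: "'e \<Rightarrow> real ^ 'p"
    and \<sigma> :: real
    and \<theta>\<^sub>0 :: 't
    and \<mu> :: "'e measure"
    and c d :: "'t \<Rightarrow> 't \<Rightarrow> real"
  assumes feller: "\<forall>\<theta>. feller_kernel (K \<theta>)"
    and mixing: "\<forall>\<theta>. mixing_kernel (K \<theta>)"
    and prob: "prob_space M"
    and signal: "markov_chain M (K \<theta>\<^sub>0) X"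
    and h_cont: "continuous_on UNIV h"
    and h_bounded: "bounded (range h)"
    and sigma_pos: "0 < \<sigma>"
    and observations: "observation_model M X V h \<sigma> Y"
    and mu: "\<mu> \<in> space (prob_algebra borel)"
    and ac: "\<forall>\<theta> \<alpha> x'. absolutely_continuous (K \<alpha> x') (K \<theta> x') \<and>
                        absolutely_continuous (K \<theta> x') (K \<alpha> x')"
    and c_pos: "\<forall>\<theta> \<alpha>. 0 < c \<theta> \<alpha>"
    and bounds: "\<forall>\<theta> \<alpha> x'. AE x in K \<alpha> x'.
        ennreal (c \<theta> \<alpha>) \<le> RN_deriv (K \<alpha> x') (K \<theta> x') x \<and>
        RN_deriv (K \<alpha> x') (K \<theta> x') x \<le> ennreal (c \<theta> \<alpha> * exp (d \<theta> \<alpha>))"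
  shows "(\<forall>\<theta> \<alpha>. \<forall>\<omega>\<in>space M. \<forall>n\<ge>1.
            hilbert_dist
                (optimal_filter (K \<theta>) (gauss_density \<sigma>) h (\<lambda>k. Y k \<omega>) \<mu> n)
                (filter_step (K \<alpha>) (gauss_density \<sigma>) h (Y n \<omega>)
                  (optimal_filter (K \<theta>) (gauss_density \<sigma>) h (\<lambda>k. Y k \<omega>) \<mu> (n - 1)))
              \<le> elog (sup_kernel_deriv (K \<theta>) (K \<alpha>) * sup_kernel_deriv (K \<alpha>) (K \<theta>)) \<and>
            elog (sup_kernel_deriv (K \<theta>) (K \<alpha>) * sup_kernel_deriv (K \<alpha>) (K \<theta>))
              \<le> ereal (d \<theta> \<alpha>)) \<and>
         (\<forall>\<alpha>. ((\<lambda>\<theta>. d \<theta> \<alpha>) \<longlongrightarrow> 0) (at \<alpha>) \<longrightarrow>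
            (\<forall>\<omega>\<in>space M.
               ((\<lambda>\<theta>. SUP n\<in>{1..}.
                   hilbert_dist
                     (optimal_filter (K \<theta>) (gauss_density \<sigma>) h (\<lambda>k. Y k \<omega>) \<mu> n)
                     (filter_step (K \<alpha>) (gauss_density \<sigma>) h (Y n \<omega>)
                       (optimal_filter (K \<theta>) (gauss_density \<sigma>) h (\<lambda>k. Y k \<omega>) \<mu> (n - 1)))) \<longlongrightarrow> 0) (at \<alpha>)))"
proof -
  have K: "K \<theta> \<in> borel \<rightarrow>\<^sub>M prob_algebra borel" for \<theta>
    using feller by (simp add: feller_kernel_def)
  have K_prob: "prob_space (K \<theta> x)" and K_sets: "sets (K \<theta> x) = sets borel" for \<theta> x
    using measurable_space[OF K, of x \<theta>] by (simp_all add: space_prob_algebra)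
  have K_fin: "finite_measure (K \<theta> x)" and K_sigma: "sigma_finite_measure (K \<theta> x)" for \<theta> x
    using K_prob by (simp_all add: prob_space.finite_measure prob_space_imp_sigma_finite)
  have [measurable]: "h \<in> borel_measurable borel"
    using h_cont by (rule borel_measurable_continuous_onI)
  have g: "(\<lambda>x. gauss_density \<sigma> (y - h x)) \<in> borel_measurable borel" for y
    by measurable
  note g_pos = gauss_density_pos[OF sigma_pos] and g_le = gauss_density_le[OF sigma_pos]
  define S where "S \<theta> \<alpha> = sup_kernel_deriv (K \<theta>) (K \<alpha>)" for \<theta> \<alpha>
  have K_le: "K \<theta> x \<le> scale_measure (S \<theta> \<alpha>) (K \<alpha> x)" for \<theta> \<alpha> x
    unfolding S_def using ac K_sets K_sigma by (intro le_scale_sup_kernel_deriv) auto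
  have S_upper: "S \<theta> \<alpha> \<le> ennreal (c \<theta> \<alpha> * exp (d \<theta> \<alpha>))" for \<theta> \<alpha>
    unfolding S_def sup_kernel_deriv_def using bounds by (intro SUP_least esssup_I) auto
  \<comment> \<open>The lower bound \<open>c\<close> on the derivative of \<open>K \<theta>\<close>
    by \<open>K \<alpha>\<close> becomes an upper bound on the derivative in the opposite
    direction.\<close>
  have S_lower: "S \<alpha> \<theta> \<le> ennreal (1 / c \<theta> \<alpha>)" for \<theta> \<alpha>
    unfolding S_def sup_kernel_deriv_def
  proof (intro SUP_least finite_measure.esssup_RN_deriv_le[OF K_fin])
    fix x
    show "K \<alpha> x \<le> scale_measure (ennreal (1 / c \<theta> \<alpha>)) (K \<theta> x)"
      using ac bounds c_pos K_sets K_sigma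
      by (intro sigma_finite_measure.le_scale_measure_of_RN_deriv_ge) auto
  qed (simp add: K_sets)
  have S_fin: "S \<theta> \<alpha> < \<infinity>" for \<theta> \<alpha>
    using S_upper[of \<theta> \<alpha>] by (simp add: le_less_trans)
  \<comment> \<open>The factor \<open>c\<close> cancels in the product of the two bounds, leaving
    \<open>exp (d \<theta> \<alpha>)\<close>.\<close>
  have S_le_d: "elog (S \<theta> \<alpha> * S \<alpha> \<theta>) \<le> ereal (d \<theta> \<alpha>)" for \<theta> \<alpha>
  proof -
    have "S \<theta> \<alpha> * S \<alpha> \<theta> \<le> ennreal (c \<theta> \<alpha> * exp (d \<theta> \<alpha>)) * ennreal (1 / c \<theta> \<alpha>)"
      using S_upper S_lower by (intro mult_mono) auto
    also have "\<dots> = ennreal (exp (d \<theta> \<alpha>))"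
      using c_pos[rule_format, of \<theta> \<alpha>] by (simp add: ennreal_mult[symmetric])
    finally show ?thesis
      using elog_mono elog_ennreal_exp by metis
  qed
  define F where "F \<theta> \<omega> n = optimal_filter (K \<theta>) (gauss_density \<sigma>) h (\<lambda>k. Y k \<omega>) \<mu> n" for \<theta> \<omega> n
  define G where "G \<theta> \<alpha> \<omega> n = filter_step (K \<alpha>) (gauss_density \<sigma>) h (Y n \<omega>) (F \<theta> \<omega> (n - 1))"
    for \<theta> \<alpha> \<omega> n
  have F_prob: "F \<theta> \<omega> n \<in> space (prob_algebra borel)" for \<theta> \<omega> n
    unfolding F_def by (rule optimal_filter_in_prob_algebra[OF K mu g g_pos g_le])
  have G_prob: "G \<theta> \<alpha> \<omega> n \<in> space (prob_algebra borel)" for \<theta> \<alpha> \<omega> n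
    unfolding G_def by (rule filter_step_in_prob_algebra[OF g g_pos g_le F_prob K])
  \<comment> \<open>For \<open>n \<ge> 1\<close> the filter is itself one step from time
    \<open>n - 1\<close>. The measures compared thus share prior and observation and differ only in
    the kernel.\<close>
  have F_step: "F \<theta> \<omega> n = G \<theta> \<theta> \<omega> n" if "1 \<le> n" for \<theta> \<omega> n
    using that by (cases n) (simp_all add: F_def G_def)
  have dist_le: "hilbert_dist (F \<theta> \<omega> n) (G \<theta> \<alpha> \<omega> n) \<le> elog (S \<theta> \<alpha> * S \<alpha> \<theta>)" if "1 \<le> n" for \<theta> \<alpha> \<omega> n
    unfolding F_step[OF that] G_def
    by (rule hilbert_dist_filter_step_le[OF g g_pos g_le F_prob K K K_le S_fin K_le S_fin])
  have dist_nonneg: "0 \<le> hilbert_dist (F \<theta> \<omega> n) (G \<theta> \<alpha> \<omega> n)" for \<theta> \<alpha> \<omega> n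
    using F_prob G_prob by (intro hilbert_dist_nonneg) (auto simp: space_prob_algebra)
  have lim: "((\<lambda>\<theta>. SUP n\<in>{1..}. hilbert_dist (F \<theta> \<omega> n) (G \<theta> \<alpha> \<omega> n)) \<longlongrightarrow> 0) (at \<alpha>)"
    if d: "((\<lambda>\<theta>. d \<theta> \<alpha>) \<longlongrightarrow> 0) (at \<alpha>)" for \<alpha> \<omega>
  proof (rule tendsto_sandwich)
    \<comment> \<open>A supremum in \<open>ereal\<close> needs a member of the index set to be
      bounded below; \<open>n = 1\<close> is taken.\<close>
    show "\<forall>\<^sub>F \<theta> in at \<alpha>. 0 \<le> (SUP n\<in>{1..}. hilbert_dist (F \<theta> \<omega> n) (G \<theta> \<alpha> \<omega> n))"
      by (intro always_eventually allI SUP_upper2[of 1] dist_nonneg) auto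
    \<comment> \<open>The bound \<open>d \<theta> \<alpha>\<close> is independent of
      \<open>n\<close>, so it passes to the supremum.\<close>
    show "\<forall>\<^sub>F \<theta> in at \<alpha>. (SUP n\<in>{1..}. hilbert_dist (F \<theta> \<omega> n) (G \<theta> \<alpha> \<omega> n)) \<le> ereal (d \<theta> \<alpha>)"
      using dist_le S_le_d by (intro always_eventually allI SUP_least) (meson atLeast_iff order_trans)
    show "((\<lambda>\<theta>. ereal (d \<theta> \<alpha>)) \<longlongrightarrow> 0) (at \<alpha>)"
      using tendsto_ereal[OF d] by (simp add: zero_ereal_def)
  qed simp
  show ?thesis
    using dist_le S_le_d lim unfolding F_def G_def S_def by blast
qed

end
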